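(* Let $\mathcal R$ be a division ring of characteristic different from $2$ with a derivation ${}'$. Let $f,g\in\mathcal R$ be invertible elements such that $f''=F_1f$ and $g''=F_2g$ for some $F_1,F_2\in\mathcal R$. Put $h=fg^{-1}$ and $G=F_1h-hF_2$, and assume $h'$ is invertible. If $G=0$, then $$h'''=\frac32\,h''(h')^{-1}h''-2h'F_2 .$$
   Context: A derivation ${}'$ on $\mathcal R$ is an additive map with $(xy)'=x'y+xy'$; $x''=(x')'$, $x'''=(x'')'$. *)

theory Defs
  imports Complex_Main
begin

definition derivation :: "('a::ring \<Rightarrow> 'a) \<Rightarrow> bool" where
  "derivation d \<longleftrightarrow> additive d \<and> (\<forall>x y. d (x * y) = d x * y + x * d y)"

text \<open>The predicate \<open>is_unit\<close> of the library is restricted to commutative structures,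
  so two-sided invertibility is spelled out.\<close>

definition invertible_elem :: "'a::monoid_mult \<Rightarrow> bool" where
  "invertible_elem x \<longleftrightarrow> (\<exists>y. x * y = 1 \<and> y * x = 1)"

end

theory Submission
  imports Defs
begin

text \<open>Put \<open>p = g' g\<inverse>\<close>, so that \<open>p' = F\<^sub>2 - p\<^sup>2\<close>. Differentiating \<open>f = h g\<close> twice gives
  \<open>h'' g + 2 h' g' = G g\<close>, hence \<open>h'' = -2 h' p\<close> when \<open>G = 0\<close>. One more differentiation yields
  \<open>h''' = -3 h'' p - 2 h' F\<^sub>2\<close>, and \<open>(h')\<inverse> h'' = -2 p\<close> eliminates \<open>p\<close>.\<close>

lemma derivation_add: "derivation d \<Longrightarrow> d (x + y) = d x + d y"
  by (simp add: derivation_def additive.add)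

lemma derivation_minus: "derivation d \<Longrightarrow> d (- x) = - d x"
  by (simp add: derivation_def additive.minus)

lemma derivation_mult: "derivation d \<Longrightarrow> d (x * y) = d x * y + x * d y"
  by (simp add: derivation_def)

lemma invertible_elem_nonzero:
  fixes x :: "'a::ring_1"
  assumes "invertible_elem x"
  shows "x \<noteq> 0"
  using assms by (auto simp: invertible_elem_def)

text \<open>If 2 vanishes, the characteristic divides 2, and it cannot be 1 because \<open>0\<close>
  and \<open>1\<close> differ in \<open>ring_1\<close>.\<close>

lemma two_neq_zero_if_CHAR_neq_2:
  assumes "CHAR('a::ring_1) \<noteq> 2"
  shows "(2::'a) \<noteq> 0"
proof
  assume "(2::'a) = 0"
  then have "of_nat 2 = (0::'a)" by simp
  then have "CHAR('a) dvd 2" by (simp only: of_nat_eq_0_iff_char_dvd)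
  then have "CHAR('a) \<le> 2" by (rule dvd_imp_le) simp
  moreover have "CHAR('a) \<noteq> 0" using \<open>CHAR('a) dvd 2\<close> by (metis dvd_0_left zero_neq_numeral)
  moreover have "CHAR('a) \<noteq> 1" by simp
  ultimately show False using assms by linarith
qed

text \<open>Noncommutative Riccati equation of the logarithmic derivative. Differentiating
  \<open>p * g = d g\<close> and cancelling \<open>g\<close> on the right avoids a formula for the
  derivative of an inverse.\<close>

lemma derivation_log_derivative:
  fixes d :: "'a::division_ring \<Rightarrow> 'a"
  assumes "derivation d" "g \<noteq> 0" "d (d g) = F * g"
  defines "p \<equiv> d g * inverse g"
  shows "d p = F - p * p"
proof -
  have pg: "p * g = d g"
    using \<open>g \<noteq> 0\<close> by (simp add: p_def mult.assoc)
  have "d p * g + p * d g = F * g"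
    using derivation_mult[OF \<open>derivation d\<close>, of p g] by (simp add: pg assms(3))
  then have "d p * g = (F - p * p) * g"
    by (simp add: pg[symmetric] algebra_simps)
  then show ?thesis
    using \<open>g \<noteq> 0\<close> by simp
qed

theorem theorem6p7:
  fixes d :: "'a::division_ring \<Rightarrow> 'a"
    and f g F\<^sub>1 F\<^sub>2 h G :: 'a
  assumes "CHAR('a) \<noteq> 2"
    and "derivation d"
    and "invertible_elem f" and "invertible_elem g"
    and "d (d f) = F\<^sub>1 * f" and "d (d g) = F\<^sub>2 * g"
    and "h = f * inverse g" and "G = F\<^sub>1 * h - h * F\<^sub>2"
    and "invertible_elem (d h)"
    and "G = 0"
  shows "d (d (d h)) = 3 / 2 * d (d h) * inverse (d h) * d (d h) - 2 * d h * F\<^sub>2"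
proof -
  note d_simps = derivation_add[OF \<open>derivation d\<close>] derivation_minus[OF \<open>derivation d\<close>]
    derivation_mult[OF \<open>derivation d\<close>]
  define p where "p = d g * inverse g"
  have g0: "g \<noteq> 0" and dh0: "d h \<noteq> 0"
    using assms by (simp_all add: invertible_elem_nonzero)
  have pg: "d g = p * g"
    using g0 by (simp add: p_def mult.assoc)
  have dp: "d p = F\<^sub>2 - p * p"
    unfolding p_def by (rule derivation_log_derivative) (use assms g0 in simp_all)
  have f: "f = h * g"
    using g0 by (simp add: \<open>h = _\<close> mult.assoc)
  have "d (d h) * g + d h * d g + (d h * d g + h * (F\<^sub>2 * g)) = F\<^sub>1 * (h * g)"
    using \<open>d (d f) = _\<close> \<open>d (d g) = _\<close> by (simp add: f d_simps)
  \<comment> \<open>This is where \<open>G = 0\<close> enters: the two terms without derivatives of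
    \<open>h\<close> cancel.\<close>
  moreover have "F\<^sub>1 * (h * g) = h * (F\<^sub>2 * g)"
    using \<open>G = _ - _\<close> \<open>G = 0\<close> by (simp flip: mult.assoc)
  ultimately have "(d (d h) + (d h * p + d h * p)) * g = 0"
    by (simp add: pg algebra_simps)
  then have "d (d h) + (d h * p + d h * p) = 0"
    using g0 by simp
  then have ddh: "d (d h) = - (d h * p + d h * p)"
    by (simp only: eq_neg_iff_add_eq_0)
  define u where "u = d (d h)"
  \<comment> \<open>The quadratic terms coming from \<open>d p\<close> turn into one more
    \<open>- (u * p)\<close>, which raises the coefficient from 2 to 3.\<close>
  have hpp: "d h * p * p + d h * p * p = - (u * p)"
    by (simp add: u_def ddh algebra_simps)
  have "d (d (d h)) = - (u * p + d h * d p + (u * p + d h * d p))"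
    by (subst ddh) (simp only: d_simps u_def)
  also have "\<dots> = d h * p * p + d h * p * p - 2 * (u * p) - 2 * d h * F\<^sub>2"
    by (simp add: dp algebra_simps mult_2)
  also have "\<dots> = - (3 * (u * p)) - 2 * d h * F\<^sub>2"
    using distrib_right[of 1 2 "u * p"] by (simp add: hpp)
  also have "- (3 * (u * p)) = 3 / 2 * u * inverse (d h) * u"
  proof -
    \<comment> \<open>The inverse has to stand to the left of \<open>u\<close>, since
      \<open>d h\<close> is the left factor in \<open>ddh\<close>.\<close>
    have "inverse (d h) * u = - (2 * p)"
      using dh0 by (simp add: u_def ddh algebra_simps mult_2 flip: mult.assoc)
    then have "3 / 2 * u * inverse (d h) * u = - (3 / 2 * (u * (p + p)))"
      by (simp only: mult.assoc mult_minus_right mult_2)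
    also have "u * (p + p) = 2 * (u * p)"
      by (simp add: distrib_left mult_2)
    also have "3 / 2 * (2 * (u * p)) = 3 / 2 * 2 * (u * p)"
      by (simp only: mult.assoc)
    \<comment> \<open>The characteristic matters here: if 2 were zero, \<open>3 / 2\<close> would be
      \<open>0\<close> by the convention for division by zero.\<close>
    also have "3 / 2 * 2 = (3 :: 'a)"
      using nonzero_eq_divide_eq[OF two_neq_zero_if_CHAR_neq_2[OF assms(1)]] by blast
    finally show ?thesis by simp
  qed
  finally show ?thesis by (simp add: u_def)
qed

end
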